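(* Let $V$ be a finite set, let $\mathcal{G}=(V,E)$ be an undirected graph, and let $\mathcal{L}\subseteq\mathcal{T}(V)$ be a relation which is bidirected pairwise Markov with respect to $\mathcal{G}$. Then $\mathcal{L}$ is bidirected global Markov with respect to $\mathcal{G}$ if and only if $\mathcal{L}\cap[\mathcal{G}]^{\rceil}$ is localizable and closed under the reverse pseudographoid rule.
   Context: For a finite set $V$, $\mathcal{T}(V)$ is the set of all triples $(A,B|C)$ with $A,B,C\subseteq V$ pairwise disjoint and $A,B$ nonempty ($C$ may be empty). A relation is an arbitrary subset of $\mathcal{T}(V)$. Juxtaposition denotes union ($BC=B\cup C$), lowercase letters denote elements of $V$ identified with singletons, and $ab=\{a,b\}$. The dual of a triple is $(A,B|C)^{\rceil}=(A,B|V\setminus ABC)$, and the dual of a relation $\mathcal{L}$ is $\mathcal{L}^{\rceil}=\{(A,B|C)\in\mathcal{T}(V):(A,B|V\setminus ABC)\in\mathcal{L}\}$. A relation $\mathcal{L}$ is localizable if for all pairwise disjoint $A,B,S\subseteq V$ with $A,B$ nonempty: $(A,B|S)\in\mathcal{L}$ if and only if $(a,b|S')\in\mathcal{L}$ for all $a\in A$, $b\in B$ and all $S'$ with $S\subseteq S'\subseteq SAB\setminus ab$. A relation $\mathcal{L}$ is closed under the reverse pseudographoid rule if for all distinct $a,b,c\in V$ and $S\subseteq V\setminus\{a,b,c\}$: $(a,b|S),(a,c|S)\in\mathcal{L}$ implies $(a,b|Sc),(a,c|Sb)\in\mathcal{L}$. An undirected graph $\mathcal{G}=(V,E)$ has $E\subseteq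 V\times V$ with $(u,v)\in E\iff(v,u)\in E$; a path is a sequence of distinct vertices in which consecutive vertices are adjacent. For pairwise disjoint $A,B,S\subseteq V$, write $A\perp_{\mathcal{G}}B|S$ if for all $a\in A,b\in B$ every path from $a$ to $b$ in $\mathcal{G}$ contains an element of $S$. Put $[\mathcal{G}]=\{(A,B|S)\in\mathcal{T}(V): A\perp_{\mathcal{G}}B|S\}$. $\mathcal{L}$ is bidirected pairwise Markov with respect to $\mathcal{G}$ if for all distinct $a,b\in V$, $(a,b)\notin E$ implies $(a,b|\emptyset)\in\mathcal{L}$. $\mathcal{L}$ is bidirected global Markov with respect to $\mathcal{G}$ if $A\perp_{\mathcal{G}}B|S$ implies $(A,B|V\setminus ABS)\in\mathcal{L}$ for all $(A,B|S)\in\mathcal{T}(V)$, i.e. $[\mathcal{G}]^{\rceil}\subseteq\mathcal{L}$.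
   Formalization: Triples are read as unordered in their first two arguments, (A,B|C) = (B,A|C), so relations are symmetric in A and B; for ordered triples with an arbitrary relation the "if" direction is false. *)

theory Defs
  imports Main "HOL-Library.Uprod"
begin

text \<open>
  The triple \<open>\<langle>A, B | C\<rangle>\<close> is unordered in its first two arguments:
  \<open>\<langle>A, B | C\<rangle> = \<langle>B, A | C\<rangle>\<close>, as usual for conditional independence statements. The
  identification matters: neither localizability nor the reverse pseudographoid rule would relate
  \<open>\<langle>a, b | S\<rangle>\<close> to \<open>\<langle>b, a | S\<rangle>\<close> if these were distinct.
\<close>

type_synonym 'a triple = "'a set uprod \<times> 'a set"

abbreviation ci_triple :: "'a set \<Rightarrow> 'a set \<Rightarrow> 'a set \<Rightarrow> 'a triple"
    (\<open>\<langle>_, _ | _\<rangle>\<close> [31, 31, 31] 1000) where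
  "\<langle>A, B | C\<rangle> \<equiv> (Upair A B, C)"

lemma ci_triple_commute: "\<langle>A, B | C\<rangle> = \<langle>B, A | C\<rangle>"
  by auto

definition triples :: "'a set \<Rightarrow> 'a triple set" where
  "triples V = {\<langle>A, B | C\<rangle> | A B C. A \<subseteq> V \<and> B \<subseteq> V \<and> C \<subseteq> V \<and>
     A \<inter> B = {} \<and> A \<inter> C = {} \<and> B \<inter> C = {} \<and> A \<noteq> {} \<and> B \<noteq> {}}"

lemma triples_iff:
  "\<langle>A, B | C\<rangle> \<in> triples V \<longleftrightarrow> A \<subseteq> V \<and> B \<subseteq> V \<and> C \<subseteq> V \<and>
     A \<inter> B = {} \<and> A \<inter> C = {} \<and> B \<inter> C = {} \<and> A \<noteq> {} \<and> B \<noteq> {}"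
  unfolding triples_def by auto

definition dual :: "'a set \<Rightarrow> 'a triple set \<Rightarrow> 'a triple set" where
  "dual V L = {\<langle>A, B | C\<rangle> | A B C.
     \<langle>A, B | C\<rangle> \<in> triples V \<and> \<langle>A, B | V - (A \<union> B \<union> C)\<rangle> \<in> L}"

lemma dual_iff:
  "\<langle>A, B | C\<rangle> \<in> dual V L \<longleftrightarrow> \<langle>A, B | C\<rangle> \<in> triples V \<and> \<langle>A, B | V - (A \<union> B \<union> C)\<rangle> \<in> L"
  (is "_ \<longleftrightarrow> ?R A B")
proof
  assume "\<langle>A, B | C\<rangle> \<in> dual V L"
  then obtain A' B' where "\<langle>A, B | C\<rangle> = \<langle>A', B' | C\<rangle>" "?R A' B'"
    unfolding dual_def by blast
  then show "?R A B" by (metis Pair_inject Un_commute Upair_inject ci_triple_commute)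
qed (auto simp only: dual_def)

definition localizable :: "'a set \<Rightarrow> 'a triple set \<Rightarrow> bool" where
  "localizable V L \<longleftrightarrow> (\<forall>A B S. \<langle>A, B | S\<rangle> \<in> triples V \<longrightarrow>
     (\<langle>A, B | S\<rangle> \<in> L \<longleftrightarrow>
       (\<forall>a\<in>A. \<forall>b\<in>B. \<forall>S'. S \<subseteq> S' \<and> S' \<subseteq> (S \<union> A \<union> B) - {a, b} \<longrightarrow> \<langle>{a}, {b} | S'\<rangle> \<in> L)))"

definition reverse_pseudographoid :: "'a set \<Rightarrow> 'a triple set \<Rightarrow> bool" where
  "reverse_pseudographoid V L \<longleftrightarrow>
     (\<forall>a\<in>V. \<forall>b\<in>V. \<forall>c\<in>V. \<forall>S. a \<noteq> b \<and> a \<noteq> c \<and> b \<noteq> c \<and> S \<subseteq> V - {a, b, c} \<longrightarrow>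
        \<langle>{a}, {b} | S\<rangle> \<in> L \<and> \<langle>{a}, {c} | S\<rangle> \<in> L \<longrightarrow>
        \<langle>{a}, {b} | S \<union> {c}\<rangle> \<in> L \<and> \<langle>{a}, {c} | S \<union> {b}\<rangle> \<in> L)"

text \<open>Loops \<open>(v, v) \<in> E\<close> are not excluded; they never lie on a path.\<close>

definition undirected_graph :: "'a set \<Rightarrow> ('a \<times> 'a) set \<Rightarrow> bool" where
  "undirected_graph V E \<longleftrightarrow> E \<subseteq> V \<times> V \<and> (\<forall>u v. (u, v) \<in> E \<longleftrightarrow> (v, u) \<in> E)"

definition path :: "'a set \<Rightarrow> ('a \<times> 'a) set \<Rightarrow> 'a \<Rightarrow> 'a list \<Rightarrow> 'a \<Rightarrow> bool" where
  "path V E a p b \<longleftrightarrow> p \<noteq> [] \<and> hd p = a \<and> last p = b \<and> set p \<subseteq> V \<and> distinct p \<and>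
     successively (\<lambda>u v. (u, v) \<in> E) p"

definition separated :: "'a set \<Rightarrow> ('a \<times> 'a) set \<Rightarrow> 'a set \<Rightarrow> 'a set \<Rightarrow> 'a set \<Rightarrow> bool" where
  "separated V E A B S \<longleftrightarrow> (\<forall>a\<in>A. \<forall>b\<in>B. \<forall>p. path V E a p b \<longrightarrow> set p \<inter> S \<noteq> {})"

definition graph_relation :: "'a set \<Rightarrow> ('a \<times> 'a) set \<Rightarrow> 'a triple set" where
  "graph_relation V E = {\<langle>A, B | S\<rangle> | A B S. \<langle>A, B | S\<rangle> \<in> triples V \<and> separated V E A B S}"

lemma separated_commute:
  assumes "undirected_graph V E"
  shows "separated V E A B S \<longleftrightarrow> separated V E B A S"
proof -
  have "path V E b (rev p) a" if "path V E a p b" for a b p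
    using that assms
    by (auto simp: path_def undirected_graph_def hd_rev last_rev
        intro: successively_mono)
  then have "separated V E B A S" if "separated V E A B S" for A B
    using that unfolding separated_def by (metis set_rev)
  then show ?thesis by blast
qed

lemma graph_relation_iff:
  assumes "undirected_graph V E"
  shows "\<langle>A, B | S\<rangle> \<in> graph_relation V E \<longleftrightarrow>
    \<langle>A, B | S\<rangle> \<in> triples V \<and> separated V E A B S"
  (is "_ \<longleftrightarrow> ?R A B")
proof
  assume "\<langle>A, B | S\<rangle> \<in> graph_relation V E"
  then obtain A' B' where "\<langle>A, B | S\<rangle> = \<langle>A', B' | S\<rangle>" "?R A' B'"
    unfolding graph_relation_def by blast
  then show "?R A B"
    by (metis Pair_inject Upair_inject ci_triple_commute separated_commute[OF assms])
qed (auto simp only: graph_relation_def)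

definition bidirected_pairwise_Markov ::
    "'a set \<Rightarrow> ('a \<times> 'a) set \<Rightarrow> 'a triple set \<Rightarrow> bool" where
  "bidirected_pairwise_Markov V E L \<longleftrightarrow>
     (\<forall>a\<in>V. \<forall>b\<in>V. a \<noteq> b \<longrightarrow> (a, b) \<notin> E \<longrightarrow> \<langle>{a}, {b} | {}\<rangle> \<in> L)"

definition bidirected_global_Markov ::
    "'a set \<Rightarrow> ('a \<times> 'a) set \<Rightarrow> 'a triple set \<Rightarrow> bool" where
  "bidirected_global_Markov V E L \<longleftrightarrow>
     (\<forall>A B S. \<langle>A, B | S\<rangle> \<in> triples V \<longrightarrow> separated V E A B S \<longrightarrow>
        \<langle>A, B | V - (A \<union> B \<union> S)\<rangle> \<in> L)"

lemma bidirected_global_Markov_iff: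
  assumes "undirected_graph V E"
  shows "bidirected_global_Markov V E L \<longleftrightarrow> dual V (graph_relation V E) \<subseteq> L"
proof -
  have inv: "\<langle>A, B | V - (A \<union> B \<union> S)\<rangle> \<in> triples V"
      "V - (A \<union> B \<union> (V - (A \<union> B \<union> S))) = S"
    if "\<langle>A, B | S\<rangle> \<in> triples V" for A B S
    using that unfolding triples_iff by auto
  show ?thesis
  proof
    assume g: "bidirected_global_Markov V E L"
    show "dual V (graph_relation V E) \<subseteq> L"
    proof
      fix t assume t: "t \<in> dual V (graph_relation V E)"
      then obtain A B S where "t = \<langle>A, B | S\<rangle>" unfolding dual_def by blast
      show "t \<in> L"
        using t g inv[of A B S]
        unfolding \<open>t = _\<close> dual_iff graph_relation_iff[OF assms] bidirected_global_Markov_def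
        by metis
    qed
  next
    assume d: "dual V (graph_relation V E) \<subseteq> L"
    show "bidirected_global_Markov V E L"
      unfolding bidirected_global_Markov_def
    proof (intro allI impI)
      fix A B S assume "\<langle>A, B | S\<rangle> \<in> triples V" "separated V E A B S"
      then have "\<langle>A, B | V - (A \<union> B \<union> S)\<rangle> \<in> dual V (graph_relation V E)"
        using inv[of A B S] by (simp only: dual_iff graph_relation_iff[OF assms])
      then show "\<langle>A, B | V - (A \<union> B \<union> S)\<rangle> \<in> L" using d by blast
    qed
  qed
qed

end

theory Submission
  imports Defs
begin

text \<open>
  Write \<open>D\<close> for \<open>dual V (graph_relation V E)\<close>. A path from \<open>A\<close> to \<open>B\<close> that avoids
  \<open>V - (A \<union> B \<union> C)\<close> is a path inside \<open>A \<union> B \<union> C\<close>, so \<open>\<langle>A, B | C\<rangle> \<in> D\<close> says that no vertex of \<open>A\<close>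
  is connected to a vertex of \<open>B\<close> in the subgraph induced on \<open>A \<union> B \<union> C\<close>
  (\<open>dual_graph_relation_iff\<close>). Once paths are replaced by reachability in induced subgraphs,
  everything rests on three facts about reachability.

  It is monotone in the vertex set, hence \<open>D\<close> is localizable. A walk from \<open>a\<close> to \<open>{b, c}\<close> meets one
  of \<open>b\<close>, \<open>c\<close> first, and up to that point it does not use the other, hence \<open>D\<close> is closed under the
  reverse pseudographoid rule. The global Markov property is \<open>D \<subseteq> L\<close>, that is,
  \<open>L \<inter> D = D\<close>, which settles one direction.

  For the converse, localizability of \<open>D\<close> and of \<open>L \<inter> D\<close> reduces \<open>D \<subseteq> L\<close> to triples
  \<open>\<langle>{a}, {b} | S\<rangle>\<close>, and these are handled by induction on \<open>S\<close>. If \<open>S\<close> is empty, then \<open>a\<close> and \<open>b\<close> are not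
  adjacent and the pairwise Markov property applies. Otherwise let \<open>c \<in> S\<close>. Reachability is an
  equivalence and \<open>a\<close>, \<open>b\<close> are not connected in \<open>S \<union> {a, b}\<close>, so \<open>c\<close> fails to be connected there to
  one of them, say to \<open>a\<close>. Then \<open>\<langle>{a}, {b} | S - {c}\<rangle>\<close> and \<open>\<langle>{a}, {c} | S - {c}\<rangle>\<close> both lie in \<open>D\<close>, hence in
  \<open>L \<inter> D\<close> by induction, and the reverse pseudographoid rule puts \<open>c\<close> back.
\<close>

text \<open>
  A vertex reaches itself even when it lies outside \<open>W\<close>, unlike with paths; this is why the
  translation back to paths below assumes that the endpoint is in \<open>W\<close>.
\<close>

definition reachable :: "('a \<times> 'a) set \<Rightarrow> 'a set \<Rightarrow> ('a \<times> 'a) set" where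
  "reachable E W = (Restr E W)\<^sup>*"

lemma reachable_if_path: "path W E a p b \<Longrightarrow> (a, b) \<in> reachable E W"
  unfolding reachable_def
proof (induction p arbitrary: a)
  case Nil
  then show ?case by (simp add: path_def)
next
  case (Cons x p)
  show ?case
  proof (cases p)
    case Nil
    then show ?thesis using Cons.prems by (auto simp: path_def)
  next
    case (Cons y q)
    then have "path W E y p b" and "(a, y) \<in> Restr E W"
      using Cons.prems by (auto simp: path_def)
    then show ?thesis using Cons.IH by (meson converse_rtrancl_into_rtrancl)
  qed
qed

text \<open>
  A walk is turned into a path, one edge at a time from its end: when the new first vertex already
  lies on the path built so far, that path is cut down to the part starting there.
\<close>

lemma path_if_reachable:
  assumes "(a, b) \<in> reachable E W" and "b \<in> W"
  shows "\<exists>p. path W E a p b"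
  using assms(1) unfolding reachable_def
proof (induction rule: converse_rtrancl_induct)
  case base
  have "path W E b [b] b" using \<open>b \<in> W\<close> by (simp add: path_def)
  then show ?case by blast
next
  case (step a x)
  then obtain p where p: "path W E x p b" by blast
  show ?case
  proof (cases "a \<in> set p")
    case True
    then obtain u v where "p = u @ a # v" by (meson split_list)
    then have "path W E a (a # v) b"
      using p by (auto simp: path_def successively_append_iff)
    then show ?thesis by blast
  next
    case False
    then have "path W E a (a # p) b"
      using p step.hyps(1) by (auto simp: path_def successively_Cons)
    then show ?thesis by blast
  qed
qed

lemma dual_graph_relation_iff:
  assumes "undirected_graph V E"
  shows "\<langle>A, B | C\<rangle> \<in> dual V (graph_relation V E) \<longleftrightarrow>
    \<langle>A, B | C\<rangle> \<in> triples V \<and> (\<forall>a\<in>A. \<forall>b\<in>B. (a, b) \<notin> reachable E (A \<union> B \<union> C))"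
proof (cases "\<langle>A, B | C\<rangle> \<in> triples V")
  case True
  let ?S = "V - (A \<union> B \<union> C)" and ?W = "A \<union> B \<union> C"
  have t: "\<langle>A, B | ?S\<rangle> \<in> triples V" and W: "?W \<subseteq> V"
    using True unfolding triples_iff by auto
  have "path V E a p b \<and> set p \<inter> ?S = {} \<longleftrightarrow> path ?W E a p b" for a b p
    using W unfolding path_def by auto
  then have "separated V E A B ?S \<longleftrightarrow> (\<forall>a\<in>A. \<forall>b\<in>B. \<not> (\<exists>p. path ?W E a p b))"
    unfolding separated_def by blast
  moreover have "(\<exists>p. path ?W E a p b) \<longleftrightarrow> (a, b) \<in> reachable E ?W" if "b \<in> B" for a b
    using path_if_reachable[of a b E ?W] reachable_if_path[of ?W E a _ b] that by blast
  ultimately have "separated V E A B ?S \<longleftrightarrow> (\<forall>a\<in>A. \<forall>b\<in>B. (a, b) \<notin> reachable E ?W)"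
    by (simp only: cong: ball_cong)
  then show ?thesis
    using True t by (simp only: dual_iff graph_relation_iff[OF assms] simp_thms)
qed (simp add: dual_iff)

lemma reachable_mono: "(a, b) \<in> reachable E W \<Longrightarrow> W \<subseteq> W' \<Longrightarrow> (a, b) \<in> reachable E W'"
  unfolding reachable_def by (meson Int_mono Sigma_mono order_refl rtrancl_mono subsetD)

text \<open>
  Monotonicity gives one direction; for the other, the largest admissible conditioning set
  \<open>S' = (S \<union> A \<union> B) - {a, b}\<close> already induces the same subgraph as \<open>\<langle>A, B | S\<rangle>\<close>.
\<close>

lemma localizable_dual_graph_relation:
  assumes "undirected_graph V E"
  shows "localizable V (dual V (graph_relation V E))"
  unfolding localizable_def
proof (intro allI impI)
  let ?D = "dual V (graph_relation V E)"
  fix A B S assume t: "\<langle>A, B | S\<rangle> \<in> triples V"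
  show "\<langle>A, B | S\<rangle> \<in> ?D \<longleftrightarrow>
    (\<forall>a\<in>A. \<forall>b\<in>B. \<forall>S'. S \<subseteq> S' \<and> S' \<subseteq> (S \<union> A \<union> B) - {a, b} \<longrightarrow> \<langle>{a}, {b} | S'\<rangle> \<in> ?D)"
  proof (intro iffI ballI allI impI)
    fix a b S'
    assume d: "\<langle>A, B | S\<rangle> \<in> ?D" and ab: "a \<in> A" "b \<in> B"
      and S': "S \<subseteq> S' \<and> S' \<subseteq> (S \<union> A \<union> B) - {a, b}"
    have "\<langle>{a}, {b} | S'\<rangle> \<in> triples V"
      using t ab S' unfolding triples_iff by auto
    moreover have "(a, b) \<notin> reachable E ({a} \<union> {b} \<union> S')"
    proof
      assume "(a, b) \<in> reachable E ({a} \<union> {b} \<union> S')"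
      then have "(a, b) \<in> reachable E (A \<union> B \<union> S)"
        by (rule reachable_mono) (use ab S' in auto)
      then show False using d ab by (simp add: dual_graph_relation_iff[OF assms])
    qed
    ultimately show "\<langle>{a}, {b} | S'\<rangle> \<in> ?D"
      by (simp add: dual_graph_relation_iff[OF assms])
  next
    assume r: "\<forall>a\<in>A. \<forall>b\<in>B. \<forall>S'. S \<subseteq> S' \<and> S' \<subseteq> (S \<union> A \<union> B) - {a, b}
      \<longrightarrow> \<langle>{a}, {b} | S'\<rangle> \<in> ?D"
    have "(a, b) \<notin> reachable E (A \<union> B \<union> S)" if ab: "a \<in> A" "b \<in> B" for a b
    proof -
      let ?S' = "(S \<union> A \<union> B) - {a, b}"
      have "S \<subseteq> ?S'" using t ab unfolding triples_iff by auto
      then have "\<langle>{a}, {b} | ?S'\<rangle> \<in> ?D" using r ab by blast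
      then have "(a, b) \<notin> reachable E ({a} \<union> {b} \<union> ?S')"
        unfolding dual_graph_relation_iff[OF assms] by blast
      moreover have "{a} \<union> {b} \<union> ?S' = A \<union> B \<union> S" using ab by auto
      ultimately show ?thesis by simp
    qed
    then show "\<langle>A, B | S\<rangle> \<in> ?D" using t by (simp add: dual_graph_relation_iff[OF assms])
  qed
qed

text \<open>
  The vertices reached from \<open>a\<close> inside \<open>W\<close> have no neighbour in \<open>{b, c}\<close>, since such a neighbour would
  be reached in \<open>insert b W\<close> or in \<open>insert c W\<close>. So adding \<open>b\<close> and \<open>c\<close> together reaches nothing new.
\<close>

lemma unreachable_insert_insert:
  assumes "a \<in> W" and "b \<notin> W"
    and "(a, b) \<notin> reachable E (insert b W)" and "(a, c) \<notin> reachable E (insert c W)"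
  shows "(a, b) \<notin> reachable E (insert b (insert c W))"
proof -
  have "x \<in> W \<and> (a, x) \<in> reachable E W" if "(a, x) \<in> reachable E (insert b (insert c W))" for x
    using that unfolding reachable_def[of E "insert b (insert c W)"]
  proof (induction rule: rtrancl_induct)
    case base
    then show ?case using assms(1) by (simp add: reachable_def)
  next
    case (step x y)
    have "(a, y) \<in> reachable E (insert y W)"
    proof -
      have "(a, x) \<in> reachable E (insert y W)"
        by (rule reachable_mono[of _ _ _ W]) (use step.IH in auto)
      moreover have "(x, y) \<in> Restr E (insert y W)" using step.IH step.hyps(2) by auto
      ultimately show ?thesis unfolding reachable_def by (rule rtrancl_into_rtrancl)
    qed
    then have "y \<noteq> b" and "y \<noteq> c" using assms(3,4) by auto
    then have "y \<in> W" using step.hyps(2) by auto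
    then show ?case
      using \<open>(a, y) \<in> reachable E (insert y W)\<close> by (simp add: insert_absorb)
  qed
  then show ?thesis using assms(2) by blast
qed

lemma reverse_pseudographoid_dual_graph_relation:
  assumes "undirected_graph V E"
  shows "reverse_pseudographoid V (dual V (graph_relation V E))"
proof -
  let ?D = "dual V (graph_relation V E)"
  \<comment> \<open>The rule is symmetric in \<open>b\<close> and \<open>c\<close>, so one of its two conclusions suffices.\<close>
  have "\<langle>{a}, {b} | S \<union> {c}\<rangle> \<in> ?D"
    if "c \<in> V" "a \<noteq> c" "b \<noteq> c" and d: "\<langle>{a}, {b} | S\<rangle> \<in> ?D" "\<langle>{a}, {c} | S\<rangle> \<in> ?D" for a b c S
  proof -
    have u: "(a, b) \<notin> reachable E (insert b (insert a S))"
        "(a, c) \<notin> reachable E (insert c (insert a S))"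
      and t: "\<langle>{a}, {b} | S\<rangle> \<in> triples V"
      using d unfolding dual_graph_relation_iff[OF assms] by (simp_all add: insert_commute)
    have "b \<notin> insert a S" using t unfolding triples_iff by auto
    then have "(a, b) \<notin> reachable E (insert b (insert c (insert a S)))"
      using unreachable_insert_insert[of a "insert a S" b E c] u by simp
    moreover have "insert b (insert c (insert a S)) = {a} \<union> {b} \<union> (S \<union> {c})" by auto
    moreover have "\<langle>{a}, {b} | S \<union> {c}\<rangle> \<in> triples V"
      using t that(1-3) unfolding triples_iff by auto
    ultimately show ?thesis unfolding dual_graph_relation_iff[OF assms] by simp
  qed
  then show ?thesis
    unfolding reverse_pseudographoid_def by (intro ballI allI impI conjI) (elim conjE; simp)+
qed

text \<open>
  Both triples induce proper subgraphs of the one on \<open>S \<union> {a, b}\<close>: the first loses \<open>c\<close>, the second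
  loses \<open>b\<close>. Hence \<open>a\<close> remains disconnected from \<open>b\<close> and from \<open>c\<close>, and the two triples are the
  premises from which the reverse pseudographoid rule recovers \<open>\<langle>{a}, {b} | S\<rangle>\<close>.
\<close>

lemma dual_graph_relation_remove:
  assumes "undirected_graph V E"
    and "\<langle>{a}, {b} | S\<rangle> \<in> dual V (graph_relation V E)" and "c \<in> S"
    and "(a, c) \<notin> reachable E ({a} \<union> {b} \<union> S)"
  shows "\<langle>{a}, {b} | S - {c}\<rangle> \<in> dual V (graph_relation V E)"
    and "\<langle>{a}, {c} | S - {c}\<rangle> \<in> dual V (graph_relation V E)"
proof -
  have t: "\<langle>{a}, {b} | S\<rangle> \<in> triples V" and u: "(a, b) \<notin> reachable E ({a} \<union> {b} \<union> S)"
    using assms(2) unfolding dual_graph_relation_iff[OF assms(1)] by simp_all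
  have "(a, b) \<notin> reachable E ({a} \<union> {b} \<union> (S - {c}))"
    using reachable_mono[of a b E "{a} \<union> {b} \<union> (S - {c})" "{a} \<union> {b} \<union> S"] u by blast
  moreover have "(a, c) \<notin> reachable E ({a} \<union> {c} \<union> (S - {c}))"
    using reachable_mono[of a c E "{a} \<union> {c} \<union> (S - {c})" "{a} \<union> {b} \<union> S"] assms(3,4)
    by blast
  moreover have "\<langle>{a}, {b} | S - {c}\<rangle> \<in> triples V" and "\<langle>{a}, {c} | S - {c}\<rangle> \<in> triples V"
    using t assms(3) unfolding triples_iff by auto
  ultimately show "\<langle>{a}, {b} | S - {c}\<rangle> \<in> dual V (graph_relation V E)"
    and "\<langle>{a}, {c} | S - {c}\<rangle> \<in> dual V (graph_relation V E)"
    unfolding dual_graph_relation_iff[OF assms(1)] by simp_all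
qed

text \<open>
  This is the inductive core: the pairwise Markov property provides the triples with empty
  conditioning set, and the reverse pseudographoid rule enlarges the set by one vertex \<open>c\<close> at a time.
  Any \<open>c \<in> S\<close> will do, because it cannot be connected to both \<open>a\<close> and \<open>b\<close>.
\<close>

lemma elementary_dual_graph_relation_mem:
  assumes "finite V" and G: "undirected_graph V E"
    and pairwise: "bidirected_pairwise_Markov V E L"
    and rule: "reverse_pseudographoid V (L \<inter> dual V (graph_relation V E))"
    and "\<langle>{a}, {b} | S\<rangle> \<in> dual V (graph_relation V E)"
  shows "\<langle>{a}, {b} | S\<rangle> \<in> L"
proof -
  let ?D = "dual V (graph_relation V E)"
  have "S \<subseteq> V" using assms(5) unfolding dual_iff triples_iff by simp
  then have "finite S" using assms(1) by (rule finite_subset)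
  then show ?thesis
    using assms(5)
  proof (induction S arbitrary: a b rule: finite_psubset_induct)
    case (psubset S)
    note d = psubset.prems
    have t: "\<langle>{a}, {b} | S\<rangle> \<in> triples V" and u: "(a, b) \<notin> reachable E ({a} \<union> {b} \<union> S)"
      using d unfolding dual_graph_relation_iff[OF G] by simp_all
    show ?case
    proof (cases "S = {}")
      case True
      have "(a, b) \<notin> E" using u by (auto simp: reachable_def)
      moreover have "a \<in> V" "b \<in> V" "a \<noteq> b" using t unfolding triples_iff by auto
      ultimately show ?thesis
        using pairwise True unfolding bidirected_pairwise_Markov_def by simp
    next
      case False
      then obtain c where c: "c \<in> S" by blast
      \<comment> \<open>The step for a \<open>c\<close> not connected to the first vertex, stated for both orders of the pair.\<close>
      have step: "\<langle>{x}, {y} | S\<rangle> \<in> L"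
        if dx: "\<langle>{x}, {y} | S\<rangle> \<in> ?D" and "(x, c) \<notin> reachable E ({x} \<union> {y} \<union> S)" for x y
      proof -
        note r = dual_graph_relation_remove[OF G dx c that(2)]
        have "S - {c} \<subset> S" using c by blast
        then have "\<langle>{x}, {y} | S - {c}\<rangle> \<in> L \<inter> ?D" "\<langle>{x}, {c} | S - {c}\<rangle> \<in> L \<inter> ?D"
          using r psubset.IH by simp_all
        moreover have "x \<in> V \<and> y \<in> V \<and> x \<noteq> y \<and> S \<subseteq> V \<and> x \<notin> S \<and> y \<notin> S"
          using dx unfolding dual_iff triples_iff by auto
        then have "x \<in> V" "y \<in> V" "c \<in> V"
            "x \<noteq> y \<and> x \<noteq> c \<and> y \<noteq> c \<and> S - {c} \<subseteq> V - {x, y, c}"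
          using c by auto
        ultimately have "\<langle>{x}, {y} | (S - {c}) \<union> {c}\<rangle> \<in> L \<inter> ?D"
          using rule[unfolded reverse_pseudographoid_def, rule_format, of x y c "S - {c}"] by simp
        moreover have "(S - {c}) \<union> {c} = S" using c by blast
        ultimately show ?thesis by (simp only: Int_iff)
      qed
      let ?R = "reachable E ({a} \<union> {b} \<union> S)"
      have "sym ?R"
        using G unfolding reachable_def
        by (intro sym_rtrancl) (auto simp: undirected_graph_def sym_def)
      moreover have "trans ?R" unfolding reachable_def by (rule trans_rtrancl)
      ultimately consider "(a, c) \<notin> ?R" | "(b, c) \<notin> ?R"
        using u by (meson symD transD)
      then show ?thesis
      proof cases
        case 1
        then show ?thesis using step d by blast
      next
        case 2
        have "\<langle>{b}, {a} | S\<rangle> \<in> L"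
        proof (rule step)
          show "\<langle>{b}, {a} | S\<rangle> \<in> ?D" using d by (simp only: ci_triple_commute[of "{b}" "{a}"])
          show "(b, c) \<notin> reachable E ({b} \<union> {a} \<union> S)"
            using 2 by (simp only: Un_commute[of "{b}" "{a}"] not_False_eq_True)
        qed
        then show ?thesis by (simp only: ci_triple_commute[of "{a}" "{b}"])
      qed
    qed
  qed
qed

theorem theorem4p5:
  fixes V :: "'a set" and E :: "('a \<times> 'a) set" and L :: "'a triple set"
  assumes "finite V"
    and "undirected_graph V E"
    and "L \<subseteq> triples V"
    and "bidirected_pairwise_Markov V E L"
  shows "bidirected_global_Markov V E L \<longleftrightarrow>
    localizable V (L \<inter> dual V (graph_relation V E)) \<and>
    reverse_pseudographoid V (L \<inter> dual V (graph_relation V E))"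
proof -
  let ?D = "dual V (graph_relation V E)"
  have "localizable V (L \<inter> ?D) \<and> reverse_pseudographoid V (L \<inter> ?D)" if "?D \<subseteq> L"
  proof -
    have "L \<inter> ?D = ?D" using that by blast
    then show ?thesis
      using localizable_dual_graph_relation[OF assms(2)]
        reverse_pseudographoid_dual_graph_relation[OF assms(2)] by simp
  qed
  moreover have "?D \<subseteq> L"
    if loc: "localizable V (L \<inter> ?D)" and rule: "reverse_pseudographoid V (L \<inter> ?D)"
  proof
    fix x assume x: "x \<in> ?D"
    then obtain A B S where eq: "x = \<langle>A, B | S\<rangle>" unfolding dual_def by blast
    have t: "\<langle>A, B | S\<rangle> \<in> triples V" using x unfolding eq dual_iff by blast
    have "\<langle>{a}, {b} | S'\<rangle> \<in> L \<inter> ?D"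
      if "a \<in> A" "b \<in> B" "S \<subseteq> S' \<and> S' \<subseteq> (S \<union> A \<union> B) - {a, b}" for a b S'
    proof -
      have "\<langle>{a}, {b} | S'\<rangle> \<in> ?D"
        using localizable_dual_graph_relation[OF assms(2)] x t that
        unfolding eq localizable_def by blast
      then show ?thesis
        using elementary_dual_graph_relation_mem[OF assms(1,2,4) rule] by blast
    qed
    then have "\<langle>A, B | S\<rangle> \<in> L \<inter> ?D" using loc t unfolding localizable_def by blast
    then show "x \<in> L" unfolding eq by blast
  qed
  ultimately show ?thesis unfolding bidirected_global_Markov_iff[OF assms(2)] by blast
qed

end
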